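(* The congested location problem (defined in the context) can be given by the following mixed-integer second-order cone program in the variables $x=(x_{ik})$, $y=(y_{ikj})$ and real variables $s=(s_{ik})$, $t=(t_{ik})$, $v=(v_{ik})$ $(i\in I,k\in K,j\in J)$: $$\min\ \sum_{i\in I}\sum_{k\in K}f_{ik}x_{ik}+\sum_{i\in I}\sum_{k\in K}\left[\frac{w_i(1+\mu_{ik}^2\sigma_{ik}^2)\,s_{ik}}{2}+\frac{w_i(1-\mu_{ik}^2\sigma_{ik}^2)\sum_{j\in J}\lambda_jy_{ikj}}{2\mu_{ik}}\right]+\sum_{i\in I}\sum_{k\in K}\sum_{j\in J}d_{ij}\lambda_jy_{ikj}$$ subject to $$2\Big(\sum_{j\in J}\lambda_jy_{ikj}\Big)^2+t_{ik}^2+v_{ik}^2\le(t_{ik}+v_{ik})^2,\quad v_{ik}=s_{ik}\mu_{ik}-\sum_{j\in J}\lambda_jy_{ikj},\quad t_{ik}=\mu_{ik}-\sum_{j\in J}\lambda_jy_{ikj}\qquad(i\in I,\ k\in K),$$ $$v_{ik}\ge0,\quad t_{ik}\ge0,\quad s_{ik}\ge0\qquad(i\in I,\ k\in K),$$ $$\sum_{i\in I}\sum_{k\in K}y_{ikj}=1\ (j\in J),\quad y_{ikj}\le x_{ik}\ (i\in I,k\in K,j\in J),\quad \sum_{k\in K}x_{ik}\le1\ (i\in I),\quad \sum_{j\in J}\lambda_jy_{ikj}\le\mu_{ik}\ (i\in I,k\in K),$$ $$x_{ik}\in\{0,1\}\ (i\in I,k\in K),\quad y_{ikj}\in\{0,1\}\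 (i\in I,k\in K,j\in J).$$ That is, the two problems have the same optimal value, and $(x,y)$ is optimal for the congested location problem if and only if there exist $s,t,v$ such that $(x,y,s,t,v)$ is optimal for this program.
   Context: Let $I,J,K$ be finite sets (facilities, customers, service-capacity levels). Parameters: real costs $f_{ik}$ and $d_{ij}$, demand rates $\lambda_j\ge0$, service rates $\mu_{ik}>0$, service-time standard deviations $\sigma_{ik}\ge0$, and waiting costs $w_i\ge0$ $(i\in I,j\in J,k\in K)$. The congested location problem is $$\min\ \sum_{i\in I}\sum_{k\in K}f_{ik}x_{ik}+\sum_{i\in I}\sum_{k\in K}w_i\,TW_{ik}+\sum_{i\in I}\sum_{k\in K}\sum_{j\in J}d_{ij}\lambda_jy_{ikj}$$ subject to $\sum_{i\in I}\sum_{k\in K}y_{ikj}=1$ $(j\in J)$; $y_{ikj}\le x_{ik}$ $(i\in I,k\in K,j\in J)$; $\sum_{k\in K}x_{ik}\le1$ $(i\in I)$; $\sum_{j\in J}\lambda_jy_{ikj}\le\mu_{ik}$ $(i\in I,k\in K)$; $x_{ik}\in\{0,1\}$ and $y_{ikj}\in\{0,1\}$ for all $i,k,j$; where $$TW_{ik}=\frac{\big(\sum_{j\in J}\lambda_jy_{ikj}\big)^2(1+\mu_{ik}^2\sigma_{ik}^2)}{2\mu_{ik}\big(\mu_{ik}-\sum_{j\in J}\lambda_jy_{ikj}\big)}+\frac{\sum_{j\in J}\lambda_jy_{ikj}}{\mu_{ik}}$$ is the expected total waiting at an M/G/1 facility. By the stability assumption on queues, points with $\sum_{j\in J}\lambda_jy_{ikj}=\mu_{ik}$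 for some $(i,k)$ are regarded as infeasible. The optimal value of an infeasible problem is $+\infty$. *)

theory Defs
  imports "HOL-Library.Extended_Real"
begin

(* All decision variables are real-valued functions on the ambient index types; only their
   values on the finite index sets I, J, K enter the constraints and the objectives. *)

definition load :: "'j set \<Rightarrow> ('j \<Rightarrow> real) \<Rightarrow> ('i \<Rightarrow> 'k \<Rightarrow> 'j \<Rightarrow> real) \<Rightarrow> 'i \<Rightarrow> 'k \<Rightarrow> real"
  where "load J lam y i k = (\<Sum>j\<in>J. lam j * y i k j)"

definition TW ::
  "'j set \<Rightarrow> ('j \<Rightarrow> real) \<Rightarrow> ('i \<Rightarrow> 'k \<Rightarrow> real) \<Rightarrow> ('i \<Rightarrow> 'k \<Rightarrow> real)
    \<Rightarrow> ('i \<Rightarrow> 'k \<Rightarrow> 'j \<Rightarrow> real) \<Rightarrow> 'i \<Rightarrow> 'k \<Rightarrow> real"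
  where "TW J lam mu sigma y i k =
    (load J lam y i k)\<^sup>2 * (1 + (mu i k)\<^sup>2 * (sigma i k)\<^sup>2)
        / (2 * mu i k * (mu i k - load J lam y i k))
      + load J lam y i k / mu i k"

definition location_constraints ::
  "'i set \<Rightarrow> 'j set \<Rightarrow> 'k set \<Rightarrow> ('j \<Rightarrow> real) \<Rightarrow> ('i \<Rightarrow> 'k \<Rightarrow> real)
    \<Rightarrow> ('i \<Rightarrow> 'k \<Rightarrow> real) \<Rightarrow> ('i \<Rightarrow> 'k \<Rightarrow> 'j \<Rightarrow> real) \<Rightarrow> bool"
  where "location_constraints I J K lam mu x y \<longleftrightarrow>
    (\<forall>j\<in>J. (\<Sum>i\<in>I. \<Sum>k\<in>K. y i k j) = 1) \<and>
    (\<forall>i\<in>I. \<forall>k\<in>K. \<forall>j\<in>J. y i k j \<le> x i k) \<and>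
    (\<forall>i\<in>I. (\<Sum>k\<in>K. x i k) \<le> 1) \<and>
    (\<forall>i\<in>I. \<forall>k\<in>K. load J lam y i k \<le> mu i k) \<and>
    (\<forall>i\<in>I. \<forall>k\<in>K. x i k \<in> {0, 1}) \<and>
    (\<forall>i\<in>I. \<forall>k\<in>K. \<forall>j\<in>J. y i k j \<in> {0, 1})"

(* The last conjunct is the stability assumption on the queues: it removes the points at
   which the denominator in TW vanishes (where HOL would evaluate the quotient to 0). *)
definition clp_feasible ::
  "'i set \<Rightarrow> 'j set \<Rightarrow> 'k set \<Rightarrow> ('j \<Rightarrow> real) \<Rightarrow> ('i \<Rightarrow> 'k \<Rightarrow> real)
    \<Rightarrow> ('i \<Rightarrow> 'k \<Rightarrow> real) \<times> ('i \<Rightarrow> 'k \<Rightarrow> 'j \<Rightarrow> real) \<Rightarrow> bool"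
  where "clp_feasible I J K lam mu = (\<lambda>(x, y).
    location_constraints I J K lam mu x y \<and>
    (\<forall>i\<in>I. \<forall>k\<in>K. load J lam y i k \<noteq> mu i k))"

definition clp_objective ::
  "'i set \<Rightarrow> 'j set \<Rightarrow> 'k set \<Rightarrow> ('i \<Rightarrow> 'k \<Rightarrow> real) \<Rightarrow> ('i \<Rightarrow> 'j \<Rightarrow> real)
    \<Rightarrow> ('j \<Rightarrow> real) \<Rightarrow> ('i \<Rightarrow> 'k \<Rightarrow> real) \<Rightarrow> ('i \<Rightarrow> 'k \<Rightarrow> real) \<Rightarrow> ('i \<Rightarrow> real)
    \<Rightarrow> ('i \<Rightarrow> 'k \<Rightarrow> real) \<times> ('i \<Rightarrow> 'k \<Rightarrow> 'j \<Rightarrow> real) \<Rightarrow> real"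
  where "clp_objective I J K f d lam mu sigma w = (\<lambda>(x, y).
    (\<Sum>i\<in>I. \<Sum>k\<in>K. f i k * x i k)
    + (\<Sum>i\<in>I. \<Sum>k\<in>K. w i * TW J lam mu sigma y i k)
    + (\<Sum>i\<in>I. \<Sum>k\<in>K. \<Sum>j\<in>J. d i j * lam j * y i k j))"

definition socp_feasible ::
  "'i set \<Rightarrow> 'j set \<Rightarrow> 'k set \<Rightarrow> ('j \<Rightarrow> real) \<Rightarrow> ('i \<Rightarrow> 'k \<Rightarrow> real)
    \<Rightarrow> ('i \<Rightarrow> 'k \<Rightarrow> real) \<times> ('i \<Rightarrow> 'k \<Rightarrow> 'j \<Rightarrow> real) \<times>
       ('i \<Rightarrow> 'k \<Rightarrow> real) \<times> ('i \<Rightarrow> 'k \<Rightarrow> real) \<times> ('i \<Rightarrow> 'k \<Rightarrow> real) \<Rightarrow> bool"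
  where "socp_feasible I J K lam mu = (\<lambda>(x, y, s, t, v).
    (\<forall>i\<in>I. \<forall>k\<in>K.
      2 * (load J lam y i k)\<^sup>2 + (t i k)\<^sup>2 + (v i k)\<^sup>2 \<le> (t i k + v i k)\<^sup>2 \<and>
      v i k = s i k * mu i k - load J lam y i k \<and>
      t i k = mu i k - load J lam y i k \<and>
      v i k \<ge> 0 \<and> t i k \<ge> 0 \<and> s i k \<ge> 0) \<and>
    location_constraints I J K lam mu x y)"

definition socp_objective ::
  "'i set \<Rightarrow> 'j set \<Rightarrow> 'k set \<Rightarrow> ('i \<Rightarrow> 'k \<Rightarrow> real) \<Rightarrow> ('i \<Rightarrow> 'j \<Rightarrow> real)
    \<Rightarrow> ('j \<Rightarrow> real) \<Rightarrow> ('i \<Rightarrow> 'k \<Rightarrow> real) \<Rightarrow> ('i \<Rightarrow> 'k \<Rightarrow> real) \<Rightarrow> ('i \<Rightarrow> real)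
    \<Rightarrow> ('i \<Rightarrow> 'k \<Rightarrow> real) \<times> ('i \<Rightarrow> 'k \<Rightarrow> 'j \<Rightarrow> real) \<times>
       ('i \<Rightarrow> 'k \<Rightarrow> real) \<times> ('i \<Rightarrow> 'k \<Rightarrow> real) \<times> ('i \<Rightarrow> 'k \<Rightarrow> real) \<Rightarrow> real"
  where "socp_objective I J K f d lam mu sigma w = (\<lambda>(x, y, s, t, v).
    (\<Sum>i\<in>I. \<Sum>k\<in>K. f i k * x i k)
    + (\<Sum>i\<in>I. \<Sum>k\<in>K.
        w i * (1 + (mu i k)\<^sup>2 * (sigma i k)\<^sup>2) * s i k / 2
        + w i * (1 - (mu i k)\<^sup>2 * (sigma i k)\<^sup>2) * load J lam y i k / (2 * mu i k))
    + (\<Sum>i\<in>I. \<Sum>k\<in>K. \<Sum>j\<in>J. d i j * lam j * y i k j))"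

(* The infimum is taken in ereal, so an infeasible problem has value \<infinity>. *)
definition optimal_value :: "('a \<Rightarrow> real) \<Rightarrow> ('a \<Rightarrow> bool) \<Rightarrow> ereal"
  where "optimal_value g P = (INF z\<in>{z. P z}. ereal (g z))"

end

(* Write L for the load of a facility, m for its service rate. Once t and v are eliminated, the
   cone constraint reads L^2 <= (m - L)(s m - L), that is L <= s (m - L). As L = m > 0 violates
   this, it encodes the stability assumption, and otherwise it says s >= L / (m - L). Since
   L^2 / (m (m - L)) = L / (m - L) - L / m, the conic waiting cost at s = L / (m - L) is exactly
   w TW, and it is nondecreasing in s. *)
theory Submission
  imports Defs
begin

text \<open>Each hypothesis sends a feasible point of one problem to a feasible point of the other
  that costs no more, which gives one inequality between the infima. Attainment plays no part, and
  either both feasible sets are empty or neither is.\<close>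

lemma optimal_value_eq_of_projection:
  assumes proj: "\<And>r. Q r \<Longrightarrow> P (p r) \<and> g (p r) \<le> h r"
    and lift: "\<And>z. P z \<Longrightarrow> \<exists>r. p r = z \<and> Q r \<and> h r = g z"
  shows "optimal_value g P = optimal_value h Q"
  unfolding optimal_value_def
proof (rule antisym)
  show "(INF z\<in>{z. P z}. ereal (g z)) \<le> (INF r\<in>{r. Q r}. ereal (h r))"
    using proj by (intro INF_mono) force
  show "(INF r\<in>{r. Q r}. ereal (h r)) \<le> (INF z\<in>{z. P z}. ereal (g z))"
    using lift by (intro INF_mono) force
qed

text \<open>A lift \<open>r\<close> of a minimizer \<open>z\<close> is optimal because
  \<open>h r = g z \<le> g (p r') \<le> h r'\<close>. Conversely, if \<open>r\<close> is optimal
  over \<open>z\<close> and \<open>r'\<close> lifts \<open>z'\<close>, then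
  \<open>g z \<le> h r \<le> h r' = g z'\<close>.\<close>

lemma is_arg_min_iff_of_projection:
  fixes g :: "'a \<Rightarrow> real" and h :: "'b \<Rightarrow> real"
  assumes proj: "\<And>r. Q r \<Longrightarrow> P (p r) \<and> g (p r) \<le> h r"
    and lift: "\<And>z. P z \<Longrightarrow> \<exists>r. p r = z \<and> Q r \<and> h r = g z"
  shows "is_arg_min g P z \<longleftrightarrow> (\<exists>r. p r = z \<and> is_arg_min h Q r)"
proof
  assume z: "is_arg_min g P z"
  then obtain r where r: "p r = z" "Q r" "h r = g z"
    using lift by (auto simp: is_arg_min_linorder)
  have "h r \<le> h r'" if "Q r'" for r'
    using proj[OF that] z r(3) by (force simp: is_arg_min_linorder)
  with r show "\<exists>r. p r = z \<and> is_arg_min h Q r"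
    by (auto simp: is_arg_min_linorder)
next
  assume "\<exists>r. p r = z \<and> is_arg_min h Q r"
  then obtain r where r: "p r = z" "Q r" and min: "\<And>r'. Q r' \<Longrightarrow> h r \<le> h r'"
    by (auto simp: is_arg_min_linorder)
  have "g z \<le> g z'" if z': "P z'" for z'
  proof -
    obtain r' where "Q r'" "h r' = g z'"
      using lift[OF z'] by blast
    with min[of r'] proj[OF r(2)] r(1) show ?thesis
      by auto
  qed
  with proj[OF r(2)] r(1) show "is_arg_min g P z"
    by (auto simp: is_arg_min_linorder)
qed

lemma load_nonneg:
  assumes "\<forall>j\<in>J. 0 \<le> lam j" and "\<forall>j\<in>J. y i k j \<in> {0, 1}"
  shows "0 \<le> load J lam y i k"
  unfolding load_def using assms by (intro sum_nonneg) force

text \<open>The difference of the two sides factors as \<open>2 * m * (s * (m - L) - L)\<close>. The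
  sign of \<open>m - L\<close> is left open, so the equivalence can serve to derive
  stability.\<close>

lemma cone_constraint_iff:
  fixes L m s :: real
  assumes "0 < m"
  shows "2 * L\<^sup>2 + (m - L)\<^sup>2 + (s * m - L)\<^sup>2 \<le> ((m - L) + (s * m - L))\<^sup>2 \<longleftrightarrow> L \<le> s * (m - L)"
proof -
  have "((m - L) + (s * m - L))\<^sup>2 - (2 * L\<^sup>2 + (m - L)\<^sup>2 + (s * m - L)\<^sup>2)
      = 2 * m * (s * (m - L) - L)"
    by (simp add: power2_eq_square algebra_simps)
  moreover have "0 \<le> 2 * m * (s * (m - L) - L) \<longleftrightarrow> L \<le> s * (m - L)"
    using assms by (simp add: zero_le_mult_iff)
  ultimately show ?thesis
    by linarith
qed

text \<open>Partial fractions turn the first term into \<open>(1 + c) / 2\<close> times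
  \<open>L / (m - L) - L / m\<close>; the coefficient of \<open>L / m\<close> is then
  \<open>1 - (1 + c) / 2 = (1 - c) / 2\<close>. Here \<open>c\<close> stands for the squared
  coefficient of variation of the service time.\<close>

lemma waiting_time_split:
  fixes L m c :: real
  assumes "0 < m" and "L < m"
  shows "L\<^sup>2 * (1 + c) / (2 * m * (m - L)) + L / m
       = (1 + c) * (L / (m - L)) / 2 + (1 - c) * L / (2 * m)"
proof -
  have "m \<noteq> 0" "m - L \<noteq> 0"
    using assms by auto
  then show ?thesis
    by (simp add: divide_simps power2_eq_square) (simp add: algebra_simps)
qed

lemma waiting_cost_eq:
  assumes "0 < mu i k" and "load J lam y i k < mu i k"
  shows "w i * TW J lam mu sigma y i k
       = w i * (1 + (mu i k)\<^sup>2 * (sigma i k)\<^sup>2)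
             * (load J lam y i k / (mu i k - load J lam y i k)) / 2
         + w i * (1 - (mu i k)\<^sup>2 * (sigma i k)\<^sup>2) * load J lam y i k / (2 * mu i k)"
  unfolding TW_def waiting_time_split[OF assms] 
  by (subst distrib_left) (simp only: mult.assoc times_divide_eq_right)

lemma socp_feasible_project:
  assumes mu: "\<forall>i\<in>I. \<forall>k\<in>K. 0 < mu i k"
    and w: "\<forall>i\<in>I. 0 \<le> w i"
    and feas: "socp_feasible I J K lam mu (x, y, s, t, v)"
  shows "clp_feasible I J K lam mu (x, y)"
    and "clp_objective I J K f d lam mu sigma w (x, y)
       \<le> socp_objective I J K f d lam mu sigma w (x, y, s, t, v)"
proof -
  let ?L = "load J lam y"
  have loc: "location_constraints I J K lam mu x y"
    using feas by (simp add: socp_feasible_def)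
  have stable: "?L i k < mu i k" and s_ge: "?L i k / (mu i k - ?L i k) \<le> s i k"
    if ik: "i \<in> I" "k \<in> K" for i k
  proof -
    have mu_pos: "0 < mu i k"
      using mu ik by blast
    have "t i k = mu i k - ?L i k" "v i k = s i k * mu i k - ?L i k"
      "2 * (?L i k)\<^sup>2 + (t i k)\<^sup>2 + (v i k)\<^sup>2 \<le> (t i k + v i k)\<^sup>2"
      using feas ik unfolding socp_feasible_def by blast+
    then have cone: "?L i k \<le> s i k * (mu i k - ?L i k)"
      by (simp only: cone_constraint_iff[OF mu_pos])
    have "?L i k \<le> mu i k"
      using loc ik by (simp add: location_constraints_def)
    \<comment> \<open>At equality the cone constraint would read
      \<open>mu i k \<le> 0\<close>.\<close>
    moreover have "?L i k \<noteq> mu i k"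
      using cone mu_pos by auto
    ultimately show "?L i k < mu i k"
      by simp
    with cone show "?L i k / (mu i k - ?L i k) \<le> s i k"
      by (simp add: pos_divide_le_eq)
  qed
  show "clp_feasible I J K lam mu (x, y)"
    using loc stable by (force simp: clp_feasible_def)
  have "w i * TW J lam mu sigma y i k
      \<le> w i * (1 + (mu i k)\<^sup>2 * (sigma i k)\<^sup>2) * s i k / 2
        + w i * (1 - (mu i k)\<^sup>2 * (sigma i k)\<^sup>2) * ?L i k / (2 * mu i k)"
    if ik: "i \<in> I" "k \<in> K" for i k
  proof -
    \<comment> \<open>This is the coefficient of \<open>s i k / 2\<close> in the conic cost, so
      raising \<open>s i k\<close> above \<open>?L i k / (mu i k - ?L i k)\<close> cannot lower the
      cost.\<close>
    have mu_pos: "0 < mu i k" and coeff_nonneg: "0 \<le> w i * (1 + (mu i k)\<^sup>2 * (sigma i k)\<^sup>2)"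
      using mu w ik by simp_all
    show ?thesis
      unfolding waiting_cost_eq[where mu = mu, OF mu_pos stable[OF ik]]
      by (intro add_right_mono divide_right_mono mult_left_mono s_ge[OF ik] coeff_nonneg) simp
  qed
  then show "clp_objective I J K f d lam mu sigma w (x, y)
      \<le> socp_objective I J K f d lam mu sigma w (x, y, s, t, v)"
    by (simp add: clp_objective_def socp_objective_def sum_mono)
qed

lemma clp_feasible_lift:
  assumes lam: "\<forall>j\<in>J. 0 \<le> lam j"
    and mu: "\<forall>i\<in>I. \<forall>k\<in>K. 0 < mu i k"
    and feas: "clp_feasible I J K lam mu (x, y)"
  shows "\<exists>s t v. socp_feasible I J K lam mu (x, y, s, t, v) \<and>
    socp_objective I J K f d lam mu sigma w (x, y, s, t, v)
      = clp_objective I J K f d lam mu sigma w (x, y)"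
proof -
  let ?L = "load J lam y"
  \<comment> \<open>The least value that the cone constraint allows, so that the constraint is
    tight; the linear equations then force \<open>t\<close> and \<open>v\<close>.\<close>
  define s where "s i k = ?L i k / (mu i k - ?L i k)" for i k
  define t where "t i k = mu i k - ?L i k" for i k
  define v where "v i k = s i k * mu i k - ?L i k" for i k
  have loc: "location_constraints I J K lam mu x y"
    using feas by (simp add: clp_feasible_def)
  have stable: "?L i k < mu i k" if "i \<in> I" "k \<in> K" for i k
    using feas that by (force simp: clp_feasible_def location_constraints_def)
  have cone: "2 * (?L i k)\<^sup>2 + (t i k)\<^sup>2 + (v i k)\<^sup>2 \<le> (t i k + v i k)\<^sup>2"
    and nonneg: "0 \<le> v i k" "0 \<le> t i k" "0 \<le> s i k"
    if ik: "i \<in> I" "k \<in> K" for i k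
  proof -
    have mu_pos: "0 < mu i k"
      using mu ik by blast
    have L_nonneg: "0 \<le> ?L i k"
      using loc ik by (intro load_nonneg lam) (simp add: location_constraints_def)
    have s_eq: "s i k * (mu i k - ?L i k) = ?L i k"
      using stable[OF ik] by (simp add: s_def)
    then show "2 * (?L i k)\<^sup>2 + (t i k)\<^sup>2 + (v i k)\<^sup>2 \<le> (t i k + v i k)\<^sup>2"
      unfolding t_def v_def cone_constraint_iff[OF mu_pos] by simp
    show "0 \<le> t i k" and s_nonneg: "0 \<le> s i k"
      using stable[OF ik] L_nonneg by (simp_all add: t_def s_def)
    \<comment> \<open>Rearranging \<open>s_eq\<close> exhibits \<open>v i k\<close> as a product of
      two nonnegative factors; the nonnegative demand rates enter here through the load.\<close>
    have "v i k = s i k * ?L i k"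
      using s_eq by (simp add: v_def algebra_simps)
    with s_nonneg L_nonneg show "0 \<le> v i k"
      by simp
  qed
  have "socp_feasible I J K lam mu (x, y, s, t, v)"
    \<comment> \<open>The facts \<open>cone\<close> and \<open>nonneg\<close> are stated with
      \<open>t\<close> and \<open>v\<close> folded, so these are unfolded only afterwards, for the
      two linear equations.\<close>
    using loc cone nonneg by (simp add: socp_feasible_def) (simp add: t_def v_def)
  moreover have "socp_objective I J K f d lam mu sigma w (x, y, s, t, v)
      = clp_objective I J K f d lam mu sigma w (x, y)"
    using mu by (simp add: clp_objective_def socp_objective_def s_def waiting_cost_eq stable)
  ultimately show ?thesis
    by blast
qed

theorem mainTheorem5:
  fixes I :: "'i set" and J :: "'j set" and K :: "'k set"
    and f :: "'i \<Rightarrow> 'k \<Rightarrow> real" and d :: "'i \<Rightarrow> 'j \<Rightarrow> real"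
    and lam :: "'j \<Rightarrow> real" and mu sigma :: "'i \<Rightarrow> 'k \<Rightarrow> real" and w :: "'i \<Rightarrow> real"
  assumes "finite I" and "finite J" and "finite K"
    and "\<forall>j\<in>J. 0 \<le> lam j"
    and "\<forall>i\<in>I. \<forall>k\<in>K. 0 < mu i k"
    and "\<forall>i\<in>I. \<forall>k\<in>K. 0 \<le> sigma i k"
    and "\<forall>i\<in>I. 0 \<le> w i"
  shows "optimal_value (clp_objective I J K f d lam mu sigma w) (clp_feasible I J K lam mu)
       = optimal_value (socp_objective I J K f d lam mu sigma w) (socp_feasible I J K lam mu)
    \<and> (\<forall>x y.
        is_arg_min (clp_objective I J K f d lam mu sigma w) (clp_feasible I J K lam mu) (x, y)
        \<longleftrightarrow> (\<exists>s t v.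
          is_arg_min (socp_objective I J K f d lam mu sigma w) (socp_feasible I J K lam mu)
            (x, y, s, t, v)))"
proof -
  let ?g = "clp_objective I J K f d lam mu sigma w" and ?P = "clp_feasible I J K lam mu"
  let ?h = "socp_objective I J K f d lam mu sigma w" and ?Q = "socp_feasible I J K lam mu"
  \<comment> \<open>Forgetting the auxiliary variables makes the conic program an extended
    formulation of the location problem.\<close>
  define p :: "('i \<Rightarrow> 'k \<Rightarrow> real) \<times> ('i \<Rightarrow> 'k \<Rightarrow> 'j \<Rightarrow> real) \<times>
      ('i \<Rightarrow> 'k \<Rightarrow> real) \<times> ('i \<Rightarrow> 'k \<Rightarrow> real) \<times> ('i \<Rightarrow> 'k \<Rightarrow> real)
      \<Rightarrow> ('i \<Rightarrow> 'k \<Rightarrow> real) \<times> ('i \<Rightarrow> 'k \<Rightarrow> 'j \<Rightarrow> real)"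
    where "p = (\<lambda>(x, y, s, t, v). (x, y))"
  have proj: "?P (p r) \<and> ?g (p r) \<le> ?h r" if "?Q r" for r
    using that by (cases r) (auto simp: p_def intro: socp_feasible_project[OF assms(5,7)])
  have lift: "\<exists>r. p r = z \<and> ?Q r \<and> ?h r = ?g z" if "?P z" for z
  proof -
    obtain x y where z: "z = (x, y)"
      by (cases z)
    with clp_feasible_lift[OF assms(4,5)] that obtain s t v
      where "?Q (x, y, s, t, v)" "?h (x, y, s, t, v) = ?g z"
      by blast
    then show ?thesis
      by (intro exI[of _ "(x, y, s, t, v)"]) (simp add: p_def z)
  qed
  have "optimal_value ?g ?P = optimal_value ?h ?Q"
    using proj lift by (rule optimal_value_eq_of_projection)
  moreover have "is_arg_min ?g ?P (x, y) \<longleftrightarrow> (\<exists>s t v. is_arg_min ?h ?Q (x, y, s, t, v))" for x y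
  proof -
    have "is_arg_min ?g ?P (x, y) \<longleftrightarrow> (\<exists>r. p r = (x, y) \<and> is_arg_min ?h ?Q r)"
      using proj lift by (rule is_arg_min_iff_of_projection)
    then show ?thesis
      by (auto simp: p_def)
  qed
  ultimately show ?thesis
    by blast
qed

end
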